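(* Let $G$ be a finite group, let $p$ be a prime dividing $|G|$, and let $P$ be a Sylow $p$-subgroup of $G$. Let $K\le Z^*(P)$ be a subgroup that is weakly closed in $P$ (with respect to $G$). Then $N_G(K)$ controls $p$-transfer in $G$.
   Context: All groups are finite. $Z^*(P)=\bigcap_{H\le P}N_P(H)$ denotes the norm of $P$ (the intersection of the normalizers in $P$ of all subgroups of $P$). A subgroup $K\le P$ is weakly closed in $P$ (with respect to $G$) if whenever $g\in G$ and $K^g\le P$, then $K^g=K$. $A^p(G)$ denotes the smallest normal subgroup of $G$ whose quotient is an abelian $p$-group. If $N\le G$ has index coprime to $p$, then $N$ controls $p$-transfer in $G$ if $N/A^p(N)\cong G/A^p(G)$. *)

theory Defs
  imports "HOL-Algebra.Algebra"
begin

definition p_group :: "nat \<Rightarrow> ('a, 'b) monoid_scheme \<Rightarrow> bool"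
  where "p_group p G \<longleftrightarrow> group G \<and> (\<exists>n. order G = p ^ n)"

definition sylow_subgroup :: "nat \<Rightarrow> 'a set \<Rightarrow> ('a, 'b) monoid_scheme \<Rightarrow> bool"
  where "sylow_subgroup p P G \<longleftrightarrow>
    subgroup P G \<and> card P = p ^ multiplicity p (order G)"

definition group_norm :: "('a, 'b) monoid_scheme \<Rightarrow> 'a set"
  where "group_norm G = (\<Inter>H \<in> {H. subgroup H G}. normalizer G H)"

definition conj_set :: "('a, 'b) monoid_scheme \<Rightarrow> 'a set \<Rightarrow> 'a \<Rightarrow> 'a set"
  where "conj_set G K g = (inv\<^bsub>G\<^esub> g) <#\<^bsub>G\<^esub> K #>\<^bsub>G\<^esub> g"

definition weakly_closed :: "('a, 'b) monoid_scheme \<Rightarrow> 'a set \<Rightarrow> 'a set \<Rightarrow> bool"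
  where "weakly_closed G P K \<longleftrightarrow>
    subgroup K (G\<lparr>carrier := P\<rparr>) \<and>
    (\<forall>g \<in> carrier G. conj_set G K g \<subseteq> P \<longrightarrow> conj_set G K g = K)"

text \<open>The least such \<open>N\<close> with respect to inclusion; for finite \<open>G\<close> it exists
  (\<open>A_p_least\<close> below).\<close>

definition A_p :: "nat \<Rightarrow> ('a, 'b) monoid_scheme \<Rightarrow> 'a set"
  where "A_p p G =
    (LEAST N. N \<lhd> G \<and> comm_group (G Mod N) \<and> p_group p (G Mod N))"

lemma (in group) A_p_closed_under_inter:
  assumes "Factorial_Ring.prime p"
    and N: "N \<lhd> G" "comm_group (G Mod N)" "p_group p (G Mod N)"
    and M: "M \<lhd> G" "comm_group (G Mod M)" "p_group p (G Mod M)"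
  shows "N \<inter> M \<lhd> G" and "comm_group (G Mod (N \<inter> M))" and "p_group p (G Mod (N \<inter> M))"
proof -
  interpret N: normal N G by fact
  interpret M: normal M G by fact
  interpret GN: comm_group "G Mod N" by fact
  interpret GM: comm_group "G Mod M" by fact
  let ?T = "(G Mod N) \<times>\<times> (G Mod M)"
  let ?h = "\<lambda>x. (N #> x, M #> x)"
  let ?I = "?T\<lparr>carrier := ?h ` carrier G\<rparr>"
  interpret T: group ?T by (intro DirProd_group GN.is_group GM.is_group)
  have T: "comm_group ?T"
    by (rule T.group_comm_groupI) (use GN.m_comm GM.m_comm in \<open>force simp: DirProd_def\<close>)
  have homT: "?h \<in> hom G ?T"
    by (intro homI) (auto simp: DirProd_def FactGroup_def RCOSETS_def N.rcos_sum M.rcos_sum)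
  interpret hT: group_hom G ?T ?h
    using homT by unfold_locales
  have sub: "subgroup (?h ` carrier G) ?T" by (rule hT.img_is_subgroup)
  have gI: "group ?I" using sub T.subgroup_imp_group by blast
  have homI: "?h \<in> hom G ?I" using homT by (auto simp: hom_def)
  interpret hI: group_hom G ?I ?h
    by (intro group_hom.intro group_hom_axioms.intro gI homI is_group)
  have memN: "N #> x = N \<longleftrightarrow> x \<in> N" and memM: "M #> x = M \<longleftrightarrow> x \<in> M" if "x \<in> carrier G" for x
    using that rcos_self[OF that N.is_subgroup] rcos_self[OF that M.is_subgroup]
      N.rcos_const M.rcos_const by auto
  have ker: "kernel G ?I ?h = N \<inter> M"
    unfolding kernel_def DirProd_def FactGroup_def
    using memN memM N.subset by auto
  have iso: "G Mod (N \<inter> M) \<cong> ?I"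
    using hI.FactGroup_iso unfolding ker by auto
  show nrm: "N \<inter> M \<lhd> G" using hI.normal_kernel unfolding ker .
  have grp: "group (G Mod (N \<inter> M))" by (rule normal.factorgroup_is_group[OF nrm])
  have "comm_group ?I"
    by (rule group.group_comm_groupI[OF gI]) (auto intro: comm_monoid.m_comm[OF comm_group.axioms(1)[OF T]] hT.hom_closed)
  then show "comm_group (G Mod (N \<inter> M))"
    using comm_group.iso_imp_comm_group group.iso_sym[OF grp iso] group.is_monoid[OF grp] by blast
  obtain a b where ab: "order (G Mod N) = p ^ a" "order (G Mod M) = p ^ b"
    using N(3) M(3) unfolding p_group_def by blast
  have I: "order ?I = card (?h ` carrier G)"
    by (simp add: order_def)
  have "order ?T = order (G Mod N) * order (G Mod M)"
    unfolding order_def DirProd_def by (simp only: partial_object.simps card_cartesian_product)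
  then have T_ord: "order ?T = p ^ (a + b)"
    by (simp only: ab power_add)
  have "order ?I dvd order ?T"
    unfolding I by (subst T.lagrange[OF sub, symmetric]) (rule dvd_triv_right)
  then have "order ?I dvd p ^ (a + b)" unfolding T_ord .
  then obtain c where "order ?I = p ^ c"
    unfolding divides_primepow_nat[OF assms(1)] by blast
  then show "p_group p (G Mod (N \<inter> M))"
    using grp iso_same_card[OF iso] unfolding p_group_def order_def by metis
qed

lemma (in group) A_p_least:
  assumes "finite (carrier G)" and "Factorial_Ring.prime p"
  shows "A_p p G \<lhd> G" and "comm_group (G Mod A_p p G)" and "p_group p (G Mod A_p p G)"
    and "\<And>N. \<lbrakk>N \<lhd> G; comm_group (G Mod N); p_group p (G Mod N)\<rbrakk> \<Longrightarrow> A_p p G \<subseteq> N"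
proof -
  let ?P = "\<lambda>N. N \<lhd> G \<and> comm_group (G Mod N) \<and> p_group p (G Mod N)"
  have n: "carrier G \<lhd> G" by (auto simp: normal_inv_iff subgroup_self)
  have triv: "carrier (G Mod carrier G) = {\<one>\<^bsub>G Mod carrier G\<^esub>}"
    using normal.fact_group_trivial_iff[OF n assms(1)] by blast
  have g: "group (G Mod carrier G)" by (rule normal.factorgroup_is_group[OF n])
  have "comm_group (G Mod carrier G)"
    by (rule group.group_comm_groupI[OF g]) (simp only: triv singleton_iff)
  moreover have "order (G Mod carrier G) = p ^ 0"
    unfolding order_def triv by simp
  ultimately have ex: "?P (carrier G)" using n g unfolding p_group_def by blast
  define N where "N = arg_min card ?P"
  have PN: "?P N" and minN: "\<And>M. ?P M \<Longrightarrow> card N \<le> card M"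
    unfolding N_def using arg_min_nat_lemma[of ?P "carrier G" card] ex by auto
  have least: "N \<subseteq> M" if "?P M" for M
  proof -
    have "?P (N \<inter> M)"
      using A_p_closed_under_inter[OF assms(2)] PN that by blast
    then have "card N \<le> card (N \<inter> M)" by (rule minN)
    moreover have "finite N"
      using PN assms(1) finite_subset normal_imp_subgroup subgroup.subset by metis
    ultimately have "N \<inter> M = N" by (intro card_seteq) auto
    then show ?thesis by blast
  qed
  have "A_p p G = N"
    unfolding A_p_def using PN least by (intro Least_equality) auto
  then show "A_p p G \<lhd> G" "comm_group (G Mod A_p p G)" "p_group p (G Mod A_p p G)"
    "\<And>N. \<lbrakk>N \<lhd> G; comm_group (G Mod N); p_group p (G Mod N)\<rbrakk> \<Longrightarrow> A_p p G \<subseteq> N"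
    using PN least by auto
qed

text \<open>Control of \<open>p\<close>-transfer is only meaningful for subgroups of index coprime to \<open>p\<close>,
  so that requirement is part of the predicate.\<close>

definition controls_p_transfer :: "nat \<Rightarrow> 'a set \<Rightarrow> ('a, 'b) monoid_scheme \<Rightarrow> bool"
  where "controls_p_transfer p N G \<longleftrightarrow>
    subgroup N G \<and> coprime (card (rcosets\<^bsub>G\<^esub> N)) p \<and>
    (G\<lparr>carrier := N\<rparr> Mod A_p p (G\<lparr>carrier := N\<rparr>)) \<cong> (G Mod A_p p G)"

end

theory Submission
  imports Defs "HOL-Number_Theory.Residues"
begin

text \<open>
  Write \<open>N\<close> for the normalizer of \<open>K\<close> and \<open>\<phi>\<close> for the projection of \<open>N\<close> onto its largest abelian
  \<open>p\<close>-quotient \<open>A\<close>. The transfer \<open>V\<close> from \<open>G\<close> to \<open>A\<close> is a homomorphism defined on all of \<open>G\<close>, and the point is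
  that it is surjective. Then \<open>A\<close> is a quotient of the largest abelian \<open>p\<close>-quotient of \<open>G\<close>; since
  \<open>N\<close> contains the Sylow subgroup \<open>P\<close>, the latter is also a quotient of \<open>A\<close>, and comparing orders
  gives the isomorphism (\<open>A_p_quotients_iso_if_epimorphism\<close>).

  To see that \<open>V\<close> is surjective, let \<open>B\<close> be the product of the image of \<open>V\<close> with the group of
  \<open>p\<close>-th powers of \<open>A\<close>. It suffices that \<open>B = A\<close>, because \<open>A\<close> is a finite abelian \<open>p\<close>-group. As
  \<open>\<phi>\<close> maps \<open>P\<close> onto \<open>A\<close>, it is enough to show \<open>\<phi> u \<in> B\<close> for the \<open>p\<close>-elements \<open>u\<close> of \<open>N\<close>, and this
  goes by induction on the order of \<open>u\<close>. By Sylow conjugacy \<open>u\<close> may be taken in \<open>P\<close>. The value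
  \<open>V u\<close> is a product over the right cosets of \<open>N\<close>, which are of three kinds.

  \<^item> The coset \<open>N\<close> itself contributes \<open>\<phi> u\<close>.

  \<^item> A nontrivial orbit of \<open>u\<close> contributes \<open>\<phi> x\<close> for a conjugate \<open>x\<close> of a power \<open>u\<^sup>n\<close> with
    \<open>p\<close> dividing \<open>n\<close> (\<open>cyclic_orbit_product\<close>). Its order is smaller than that of \<open>u\<close>, so \<open>\<phi> x \<in> B\<close>.

  \<^item> On the cosets other than \<open>N\<close> that \<open>u\<close> fixes, \<open>K\<close> acts, because elements of the norm of \<open>P\<close>
    normalize the subgroup generated by \<open>u\<close>. Weak closure and Sylow conjugacy in \<open>N\<close> imply that
    \<open>K\<close> fixes no coset but \<open>N\<close>, so every \<open>K\<close>-orbit here has size divisible by \<open>p\<close>. Moving a coset by \<open>k\<close> in \<open>K\<close> raises its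
    contribution to the exponent \<open>m\<close> given by \<open>k u k\<^sup>-\<^sup>1 = u\<^sup>m\<close>
    (\<open>factor_fixed_translate\<close>). As \<open>k\<close> is a \<open>p\<close>-element, \<open>m\<close> is \<open>1\<close> modulo \<open>p\<close>
    (\<open>power_automorphism_exponent\<close>), so modulo \<open>p\<close>-th powers the contributions along an orbit agree
    and their product is trivial.

  Hence \<open>V u\<close> and \<open>\<phi> u\<close> agree modulo \<open>B\<close> (\<open>transfer_congruence\<close>), and \<open>\<phi> u \<in> B\<close> follows.
\<close>

section \<open>Right translations permuting a family of sets\<close>

lemma (in comm_group) finprod_in_subgroup:
  assumes B: "subgroup B G" and "finite S" "\<And>x. x \<in> S \<Longrightarrow> g x \<in> B"
  shows "finprod G g S \<in> B"
  using assms(2,3)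
proof (induction S)
  case empty
  then show ?case using subgroup.one_closed[OF B] by simp
next
  case (insert x S)
  then have "g \<in> insert x S \<rightarrow> carrier G"
    using subgroup.mem_carrier[OF B] by blast
  then show ?case
    using insert subgroup.m_closed[OF B] by (simp add: finprod_insert)
qed

text \<open>The members of \<open>\<Omega>\<close> will be right cosets, so that \<open>L\<close> acts on them from the right. Since \<open>\<Omega>\<close> may be any
closed family of sets, the orbit counting below applies to parts of the coset space, such as the
cosets that a given element fixes.\<close>

locale right_translations = group +
  fixes L :: "'a set" and \<Omega> :: "'a set set"
  assumes L: "subgroup L G"
    and subsets: "c \<in> \<Omega> \<Longrightarrow> c \<subseteq> carrier G"
    and closed: "c \<in> \<Omega> \<Longrightarrow> l \<in> L \<Longrightarrow> c #> l \<in> \<Omega>"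
begin

definition orb :: "'a set \<Rightarrow> 'a set set"
  where "orb c = (\<lambda>l. c #> l) ` L"

definition orb_rel :: "('a set \<times> 'a set) set"
  where "orb_rel = {(c, d). c \<in> \<Omega> \<and> d \<in> orb c}"

lemma in_L [simp]: "l \<in> L \<Longrightarrow> l \<in> carrier G"
  by (rule subgroup.mem_carrier[OF L])

lemma L_one [simp]: "\<one> \<in> L"
  and L_inv [simp]: "l \<in> L \<Longrightarrow> inv l \<in> L"
  and L_mult [simp]: "l \<in> L \<Longrightarrow> m \<in> L \<Longrightarrow> l \<otimes> m \<in> L"
  using L by (simp_all add: subgroup.one_closed subgroup.m_inv_closed subgroup.m_closed)

lemma translate_translate [simp]:
  "\<lbrakk>c \<in> \<Omega>; l \<in> L; m \<in> L\<rbrakk> \<Longrightarrow> c #> l #> m = c #> (l \<otimes> m)"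
  by (simp add: coset_mult_assoc subsets)

lemma translate_one [simp]: "c \<in> \<Omega> \<Longrightarrow> c #> \<one> = c"
  by (simp add: coset_mult_one subsets)

lemma orb_subset: "c \<in> \<Omega> \<Longrightarrow> orb c \<subseteq> \<Omega>"
  by (auto simp: orb_def closed)

lemma equiv_orb_rel: "equiv \<Omega> orb_rel"
proof (rule equivI)
  show "orb_rel \<subseteq> \<Omega> \<times> \<Omega>"
    using orb_subset by (auto simp: orb_rel_def)
  show "refl_on \<Omega> orb_rel"
  proof (rule refl_onI)
    fix c assume c: "c \<in> \<Omega>"
    have "c #> \<one> \<in> orb c"
      unfolding orb_def using L_one by (rule imageI)
    then show "(c, c) \<in> orb_rel" using c by (simp add: orb_rel_def)
  qed
  show "sym orb_rel"
  proof (rule symI)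
    fix c d assume "(c, d) \<in> orb_rel"
    then obtain l where l: "c \<in> \<Omega>" "l \<in> L" "d = c #> l"
      by (auto simp: orb_rel_def orb_def)
    then have "inv l \<in> L" "c = d #> inv l"
      by simp_all
    then have "c \<in> orb d"
      unfolding orb_def by (metis imageI)
    moreover have "d \<in> \<Omega>"
      using l closed by simp
    ultimately show "(d, c) \<in> orb_rel"
      by (simp add: orb_rel_def)
  qed
  show "trans orb_rel"
  proof (rule transI)
    fix c d e assume "(c, d) \<in> orb_rel" "(d, e) \<in> orb_rel"
    then obtain l m where "c \<in> \<Omega>" "l \<in> L" "d = c #> l" "m \<in> L" "e = d #> m"
      by (auto simp: orb_rel_def orb_def)
    then have "c \<in> \<Omega>" "l \<otimes> m \<in> L" "e = c #> (l \<otimes> m)"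
      by simp_all
    then show "(c, e) \<in> orb_rel"
      unfolding orb_rel_def orb_def by auto
  qed
qed

lemma quotient_orb_rel: "C \<in> \<Omega> // orb_rel \<Longrightarrow> \<exists>c\<in>\<Omega>. C = orb c"
  by (auto simp: quotient_def orb_rel_def Image_def)

text \<open>Each fibre of \<open>l \<mapsto> c #> l\<close> is a coset of the stabilizer of \<open>c\<close> in \<open>L\<close>, so all fibres have the same size.\<close>

lemma card_orb_dvd:
  assumes "finite L" "c \<in> \<Omega>"
  shows "card (orb c) dvd card L"
proof -
  let ?S = "{l \<in> L. c #> l = c}"
  have "card {l \<in> L. c #> l = d} = card ?S" if d: "d \<in> orb c" for d
  proof -
    obtain m where m: "m \<in> L" "d = c #> m" using d by (auto simp: orb_def)
    have "{l \<in> L. c #> l = d} = (\<lambda>s. s \<otimes> m) ` ?S"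
    proof (intro equalityI subsetI)
      fix l assume l: "l \<in> {l \<in> L. c #> l = d}"
      then have l': "l \<in> L" "c #> l = d" by auto
      have "c #> (l \<otimes> inv m) = c #> l #> inv m"
        using l'(1) m(1) assms(2) by simp
      also have "\<dots> = c #> m #> inv m" by (simp only: l'(2) m(2))
      also have "\<dots> = c"
        using m(1) assms(2) by simp
      finally have "l \<otimes> inv m \<in> ?S"
        using l'(1) m(1) by simp
      moreover have "l = (l \<otimes> inv m) \<otimes> m"
        using l m by (simp add: m_assoc)
      ultimately show "l \<in> (\<lambda>s. s \<otimes> m) ` ?S" by blast
    next
      fix l assume "l \<in> (\<lambda>s. s \<otimes> m) ` ?S"
      then obtain s where s: "s \<in> L" "c #> s = c" "l = s \<otimes> m" by blast
      have "c #> (s \<otimes> m) = c #> s #> m" using s(1) m assms(2) by simp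
      then show "l \<in> {l \<in> L. c #> l = d}"
        using s m by simp
    qed
    moreover have "inj_on (\<lambda>s. s \<otimes> m) ?S"
      using m by (auto simp: inj_on_def)
    ultimately show ?thesis by (simp add: card_image)
  qed
  moreover have "card L = (\<Sum>d\<in>orb c. card {l \<in> L. c #> l = d})"
    using sum.image_gen[OF assms(1), of "\<lambda>_. 1::nat" "\<lambda>l. c #> l"] by (simp add: orb_def)
  ultimately show ?thesis by simp
qed

lemma prime_dvd_card_orb:
  assumes "Factorial_Ring.prime p" "card L = p ^ n" "c \<in> \<Omega>" "l \<in> L" "c #> l \<noteq> c"
  shows "p dvd card (orb c)"
proof -
  have fin: "finite L"
    using assms(1,2) by (metis card.infinite power_not_zero not_prime_0)
  obtain i where i: "card (orb c) = p ^ i"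
    using card_orb_dvd[OF fin assms(3)] assms(1,2) divides_primepow_nat by metis
  have "card (orb c) \<noteq> 1"
  proof
    assume "card (orb c) = 1"
    then obtain d where d: "orb c = {d}" by (auto simp: card_1_singleton_iff)
    have "c #> \<one> \<in> orb c" "c #> l \<in> orb c"
      using L_one assms(4) unfolding orb_def by blast+
    then show False using d assms(3,5) by auto
  qed
  then show ?thesis using i by (cases i) auto
qed

lemma prime_dvd_card_no_fixed_points:
  assumes "Factorial_Ring.prime p" "card L = p ^ n" "finite \<Omega>"
    and "\<And>c. c \<in> \<Omega> \<Longrightarrow> \<exists>l\<in>L. c #> l \<noteq> c"
  shows "p dvd card \<Omega>"
  using equiv_imp_dvd_card[OF assms(3) equiv_orb_rel] quotient_orb_rel
    prime_dvd_card_orb[OF assms(1,2)] assms(4) by metis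

text \<open>Splitting a product into orbits controls the contributions to the transfer from all cosets but \<open>N\<close>
itself: along orbits of a cyclic group, and along orbits of \<open>K\<close>.\<close>

lemma finprod_by_orbits:
  assumes "comm_group A" "subgroup B A" "finite \<Omega>" "f \<in> \<Omega> \<rightarrow> carrier A"
    and "\<And>c. c \<in> \<Omega> \<Longrightarrow> finprod A f (orb c) \<in> B"
  shows "finprod A f \<Omega> \<in> B"
proof -
  interpret A: comm_group A by fact
  have "finprod A f (\<Union>(\<Omega> // orb_rel)) = finprod A (finprod A f) (\<Omega> // orb_rel)"
  proof (rule A.finprod_Union_disjoint)
    show "finite (\<Omega> // orb_rel)"
      using assms(3) equiv_orb_rel by (simp add: finite_quotient equiv_type)
    have "C \<subseteq> \<Omega>" if "C \<in> \<Omega> // orb_rel" for C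
      using that Union_quotient[OF equiv_orb_rel] by blast
    then show "\<And>C. C \<in> \<Omega> // orb_rel \<Longrightarrow> finite C \<and> (\<forall>x\<in>C. f x \<in> carrier A)"
      using assms(3,4) by (meson Pi_mem finite_subset subsetD)
    show "pairwise disjnt (\<Omega> // orb_rel)"
      using quotient_disj[OF equiv_orb_rel] by (auto simp: pairwise_def disjnt_def)
  qed
  also have "\<dots> \<in> B"
  proof (rule A.finprod_in_subgroup[OF assms(2)])
    show "finite (\<Omega> // orb_rel)"
      using assms(3) equiv_orb_rel by (simp add: finite_quotient equiv_type)
    show "\<And>C. C \<in> \<Omega> // orb_rel \<Longrightarrow> finprod A f C \<in> B"
      using assms(5) quotient_orb_rel by blast
  qed
  finally show ?thesis using Union_quotient[OF equiv_orb_rel] by simp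
qed

end

section \<open>Conjugating p-subgroups into a Sylow subgroup\<close>

lemma (in group) coset_translate_fixed_iff:
  assumes "subgroup H G" "t \<in> carrier G" "x \<in> carrier G"
  shows "H #> t #> x = H #> t \<longleftrightarrow> t \<otimes> x \<otimes> inv t \<in> H"
proof
  assume "H #> t #> x = H #> t"
  then have "H #> (t \<otimes> x) = H #> t"
    using assms by (simp add: coset_mult_assoc subgroup.subset)
  then have "t \<otimes> x \<in> H #> t"
    using assms repr_independenceD[of H "t \<otimes> x" t] rcos_self[of "t \<otimes> x" H] by auto
  then obtain h where "h \<in> H" "t \<otimes> x = h \<otimes> t" by (auto simp: r_coset_def)
  then show "t \<otimes> x \<otimes> inv t \<in> H"
    using assms by (metis inv_solve_right m_closed subgroup.mem_carrier)
next
  assume h: "t \<otimes> x \<otimes> inv t \<in> H"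
  have "H #> t #> x = H #> (t \<otimes> x \<otimes> inv t) #> t"
    using assms by (simp add: coset_mult_assoc subgroup.subset m_assoc)
  also have "\<dots> = H #> t"
    using h assms by (simp add: coset_join2)
  finally show "H #> t #> x = H #> t" .
qed

text \<open>This is Sylow's conjugacy theorem inside \<open>N\<close>, applied to \<open>t Q t\<^sup>-\<^sup>1\<close>. The group \<open>Q\<close> acts by right
translation on the \<open>r\<close> cosets of \<open>P\<close> contained in \<open>N #> t\<close>, and a \<open>p\<close>-group acting on a set of size
prime to \<open>p\<close> has a fixed point. Phrasing it with \<open>Q\<close> and \<open>t\<close> instead of the conjugated subgroup serves
both purposes at hand: \<open>t = \<one>\<close> for cyclic \<open>Q\<close>, and arbitrary \<open>t\<close> for \<open>Q = K\<close>.\<close>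

lemma (in group) p_subgroup_conj_into_sylow:
  assumes "finite (carrier G)" "Factorial_Ring.prime p"
    and P: "subgroup P G" and N: "subgroup N G" and "P \<subseteq> N"
    and card_N: "card N = card P * r" "\<not> p dvd r"
    and Q: "subgroup Q G" "card Q = p ^ b"
    and t: "t \<in> carrier G" "\<And>q. q \<in> Q \<Longrightarrow> t \<otimes> q \<otimes> inv t \<in> N"
  shows "\<exists>h\<in>N. \<forall>q\<in>Q. (h \<otimes> t) \<otimes> q \<otimes> inv (h \<otimes> t) \<in> P"
proof -
  define \<Omega> where "\<Omega> = (\<lambda>n. P #> n #> t) ` N"
  have mem [simp]: "x \<in> carrier G" if "x \<in> N \<or> x \<in> Q" for x
    using that subgroup.mem_carrier[OF N] subgroup.mem_carrier[OF Q(1)] by blast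
  have assoc: "P #> x #> y = P #> (x \<otimes> y)" if "x \<in> carrier G" "y \<in> carrier G" for x y
    using that by (simp add: coset_mult_assoc subgroup.subset[OF P])
  have P_sub: "P #> x \<subseteq> carrier G" if "x \<in> carrier G" for x
    using that by (simp add: r_coset_subset_G subgroup.subset[OF P])
  interpret right_translations G Q \<Omega>
  proof (intro right_translations.intro right_translations_axioms.intro is_group)
    show "subgroup Q G" by fact
    show "c \<subseteq> carrier G" if c: "c \<in> \<Omega>" for c
    proof -
      obtain n where "n \<in> N" "c = P #> n #> t" using c by (auto simp: \<Omega>_def)
      then show ?thesis
        using t(1) by (simp add: assoc P_sub)
    qed
    show "c #> l \<in> \<Omega>" if c: "c \<in> \<Omega>" and l: "l \<in> Q" for c l
    proof -
      obtain n where n: "n \<in> N" "c = P #> n #> t" using c by (auto simp: \<Omega>_def)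
      have "c #> l = P #> (n \<otimes> (t \<otimes> l \<otimes> inv t)) #> t"
        unfolding n(2) using n(1) l t(1) by (simp add: assoc m_assoc)
      then show ?thesis
        using n(1) t(2)[OF l] subgroup.m_closed[OF N] by (auto simp: \<Omega>_def)
    qed
  qed
  interpret N: group "G\<lparr>carrier := N\<rparr>" using N by (rule subgroup_imp_group)
  have "rcosets\<^bsub>G\<lparr>carrier := N\<rparr>\<^esub> P = (\<lambda>n. P #> n) ` N"
    by (auto simp: RCOSETS_def r_coset_def)
  then have "\<Omega> = (\<lambda>c. c #> t) ` (rcosets\<^bsub>G\<lparr>carrier := N\<rparr>\<^esub> P)"
    by (simp only: \<Omega>_def image_image)
  moreover have "inj_on (\<lambda>c. c #> t) (rcosets\<^bsub>G\<lparr>carrier := N\<rparr>\<^esub> P)"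
  proof (rule inj_on_inverseI[where g = "\<lambda>c. c #> inv t"])
    fix c assume "c \<in> rcosets\<^bsub>G\<lparr>carrier := N\<rparr>\<^esub> P"
    then obtain n where "n \<in> N" "c = P #> n" by (auto simp: RCOSETS_def r_coset_def)
    then show "c #> t #> inv t = c"
      using t(1) by (simp add: assoc m_assoc)
  qed
  ultimately have "card \<Omega> = card (rcosets\<^bsub>G\<lparr>carrier := N\<rparr>\<^esub> P)"
    by (simp add: card_image)
  moreover have "subgroup P (G\<lparr>carrier := N\<rparr>)"
    using P N \<open>P \<subseteq> N\<close> by (simp add: subgroup_incl)
  ultimately have "card \<Omega> * card P = card N"
    using N.lagrange[of P] by (simp add: order_def)
  moreover have "card P > 0"
    using P assms(1) subgroup.finite_imp_card_positive by blast
  ultimately have "card \<Omega> = r" using card_N(1) by simp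
  moreover have "finite \<Omega>"
    unfolding \<Omega>_def using assms(1) N finite_subset subgroup.subset by blast
  ultimately obtain c where c: "c \<in> \<Omega>" "\<forall>q\<in>Q. c #> q = c"
    using prime_dvd_card_no_fixed_points[OF assms(2) Q(2)] card_N(2) by blast
  then obtain h where h: "h \<in> N" "c = P #> (h \<otimes> t)" using t(1) by (auto simp: \<Omega>_def assoc)
  have "(h \<otimes> t) \<otimes> q \<otimes> inv (h \<otimes> t) \<in> P" if q: "q \<in> Q" for q
    using c(2) q h t(1) coset_translate_fixed_iff[OF P, of "h \<otimes> t" q] by simp
  then show ?thesis using h(1) by blast
qed

lemma (in group) card_generate_p_element:
  assumes "Factorial_Ring.prime p" "u \<in> carrier G" "u [^] (p ^ e) = \<one>"
  shows "\<exists>j. card (generate G {u}) = p ^ j"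
  using assms pow_eq_id divides_primepow_nat generate_pow_card by metis

lemma (in group) pow_cong:
  assumes "x \<in> carrier G" "x [^] n = \<one>" "[i = j] (mod n)"
  shows "x [^] i = x [^] (j::nat)"
proof -
  have "x [^] i = x [^] (i mod n)" for i :: nat
  proof -
    have "x [^] (n * (i div n) + i mod n) = (x [^] n) [^] (i div n) \<otimes> x [^] (i mod n)"
      using assms(1) by (simp add: nat_pow_mult nat_pow_pow)
    then show ?thesis using assms(1,2) by simp
  qed
  then show ?thesis using assms(3) unfolding cong_def by metis
qed

text \<open>If \<open>r\<close> is the index of \<open>P\<close>, then \<open>g\<^sup>r\<close> is a \<open>p\<close>-element, hence conjugate into \<open>P\<close>; an abelian image
does not see the conjugation, and raising to the power \<open>r\<close> is invertible on a \<open>p\<close>-group.\<close>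

lemma (in group) hom_image_sylow:
  assumes fin: "finite (carrier G)" and p: "Factorial_Ring.prime p"
    and P: "subgroup P G" "card P = p ^ a" "order G = card P * r" "\<not> p dvd r"
    and C: "comm_group C" "order C = p ^ b" and \<psi>: "\<psi> \<in> hom G C"
  shows "\<psi> ` carrier G = \<psi> ` P"
proof
  interpret C: comm_group C by fact
  interpret \<psi>: group_hom G C \<psi> using \<psi> by unfold_locales
  show "\<psi> ` P \<subseteq> \<psi> ` carrier G" using subgroup.subset[OF P(1)] by blast
  show "\<psi> ` carrier G \<subseteq> \<psi> ` P"
  proof safe
    fix g assume g: "g \<in> carrier G"
    define y where "y = g [^] r"
    have y: "y \<in> carrier G" using g by (simp add: y_def)
    have "y [^] (p ^ a) = g [^] order G"
      using g P(2,3) by (simp add: y_def nat_pow_pow mult.commute)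
    then have "y [^] (p ^ a) = \<one>" using pow_order_eq_1[OF g] by simp
    then obtain j where j: "card (generate G {y}) = p ^ j"
      using card_generate_p_element[OF p y] by blast
    have sub: "subgroup (generate G {y}) G" using y by (simp add: generate_is_subgroup)
    have Y: "q \<in> carrier G" if "q \<in> generate G {y}" for q
      using sub that by (rule subgroup.mem_carrier)
    have "card (carrier G) = card P * r" using P(3) by (simp add: order_def)
    then have "\<exists>h\<in>carrier G. \<forall>q\<in>generate G {y}. (h \<otimes> \<one>) \<otimes> q \<otimes> inv (h \<otimes> \<one>) \<in> P"
      using y Y by (intro p_subgroup_conj_into_sylow[OF fin p P(1) subgroup_self subgroup.subset[OF P(1)] _ P(4) _ j one_closed])
        (simp_all add: generate_is_subgroup)
    then obtain h where h: "h \<in> carrier G" "\<And>q. q \<in> generate G {y} \<Longrightarrow> h \<otimes> q \<otimes> inv h \<in> P"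
      by auto
    define x where "x = h \<otimes> y \<otimes> inv h"
    have x: "x \<in> P"
      using h(2)[of y] h(1) by (simp add: x_def generate.incl)
    have "\<psi> x = \<psi> h \<otimes>\<^bsub>C\<^esub> \<psi> y \<otimes>\<^bsub>C\<^esub> inv\<^bsub>C\<^esub> \<psi> h"
      using h(1) y by (simp add: x_def)
    also have "\<dots> = \<psi> y"
      using h(1) y by (simp add: C.m_comm[of "\<psi> h"] C.m_assoc)
    finally have \<psi>x: "\<psi> x = \<psi> g [^]\<^bsub>C\<^esub> r"
      using g by (simp add: y_def \<psi>.hom_nat_pow)
    have "coprime r (p ^ b)"
      using P(4) p by (metis coprime_commute coprime_power_left_iff prime_imp_coprime)
    then obtain s where s: "[r * s = 1] (mod p ^ b)"
      using cong_solve_coprime_nat[of r "p ^ b"] by auto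
    have "\<psi> (x [^] s) = \<psi> g [^]\<^bsub>C\<^esub> (r * s)"
      using x g subgroup.mem_carrier[OF P(1)] by (simp add: \<psi>.hom_nat_pow \<psi>x C.nat_pow_pow)
    also have "\<dots> = \<psi> g [^]\<^bsub>C\<^esub> (1::nat)"
      using C.pow_cong[OF _ _ s] C.pow_order_eq_1 C(2) g by (metis \<psi>.hom_closed)
    finally have "\<psi> g = \<psi> (x [^] s)" using g by simp
    moreover have "x [^] s \<in> P"
      by (induction s) (simp_all add: x subgroup.one_closed[OF P(1)] subgroup.m_closed[OF P(1)])
    ultimately show "\<psi> g \<in> \<psi> ` P" by blast
  qed
qed

section \<open>Automorphisms of p-power order that raise an element to a power\<close>

lemma (in group) pow_conj:
  assumes "t \<in> carrier G" "u \<in> carrier G"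
  shows "t \<otimes> u [^] (m::nat) \<otimes> inv t = (t \<otimes> u \<otimes> inv t) [^] m"
proof (induction m)
  case 0
  then show ?case using assms by simp
next
  case (Suc m)
  have "(t \<otimes> u [^] m \<otimes> inv t) \<otimes> (t \<otimes> u \<otimes> inv t) = t \<otimes> u [^] m \<otimes> (inv t \<otimes> t) \<otimes> u \<otimes> inv t"
    using assms by (simp only: m_assoc m_closed inv_closed nat_pow_closed)
  then show ?case
    using assms Suc by (simp add: m_assoc)
qed

text \<open>Fermat's little theorem, iterated.\<close>

lemma prime_power_pow_cong:
  fixes p m :: nat
  assumes "Factorial_Ring.prime p"
  shows "[m ^ (p ^ a) = m] (mod p)"
proof -
  have fermat: "[k ^ p = k] (mod p)" for k :: nat
  proof (cases "p dvd k")
    case True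
    moreover have "k dvd k ^ p" using prime_gt_0_nat[OF assms] by (simp add: dvd_power)
    ultimately have "p dvd k ^ p" by (rule dvd_trans)
    then show ?thesis using True by (simp add: cong_def)
  next
    case False
    have "[k * k ^ (p - 1) = k * 1] (mod p)"
      using fermat_theorem[OF assms False] by (rule cong_scalar_left)
    then show ?thesis
      using prime_gt_0_nat[OF assms] by (simp add: power_eq_if)
  qed
  show ?thesis
  proof (induction a)
    case (Suc a)
    have "[(m ^ (p ^ a)) ^ p = m ^ (p ^ a)] (mod p)" by (rule fermat)
    then have "[(m ^ (p ^ a)) ^ p = m] (mod p)" using Suc cong_trans by blast
    then show ?case by (simp add: power_mult[symmetric] mult.commute)
  qed simp
qed

text \<open>Conjugating \<open>p\<^sup>a\<close> times by \<open>k\<close> is trivial, so \<open>m\<close> to the power \<open>p\<^sup>a\<close> is \<open>1\<close> modulo the order of \<open>u\<close>, in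
particular modulo \<open>p\<close>; but by Fermat that power is congruent to \<open>m\<close> itself.\<close>

lemma (in group) power_automorphism_exponent:
  fixes m :: nat
  assumes p: "Factorial_Ring.prime p"
    and u: "u \<in> carrier G" "u \<noteq> \<one>" "u [^] (p ^ e) = \<one>"
    and k: "k \<in> carrier G" "k [^] (p ^ a) = \<one>" "k \<otimes> u \<otimes> inv k = u [^] m"
  shows "[m = 1] (mod p)"
proof -
  have iter: "k [^] i \<otimes> u \<otimes> inv (k [^] i) = u [^] (m ^ i)" for i :: nat
  proof (induction i)
    case 0
    then show ?case using u by simp
  next
    case (Suc i)
    have "k [^] Suc i \<otimes> u \<otimes> inv (k [^] Suc i) = k [^] i \<otimes> (k \<otimes> u \<otimes> inv k) \<otimes> inv (k [^] i)"
      using k(1) u(1) by (simp add: inv_mult_group m_assoc)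
    also have "\<dots> = (k [^] i \<otimes> u \<otimes> inv (k [^] i)) [^] m"
      using k u by (simp add: pow_conj)
    also have "\<dots> = u [^] (m ^ Suc i)"
      using u(1) by (simp add: Suc nat_pow_pow mult.commute)
    finally show ?case .
  qed
  obtain j where j: "ord u = p ^ j"
    using u(1,3) pow_eq_id divides_primepow_nat[OF p] by blast
  have "j \<noteq> 0" using j u(1,2) ord_eq_1 by (metis power_0)
  have "u [^] (m ^ (p ^ a)) = u [^] (1::nat)"
    using iter[of "p ^ a"] u(1) k(2) by simp
  then have "u [^] int (m ^ (p ^ a)) = u [^] int 1"
    by (simp only: int_pow_int)
  then have "int (ord u) dvd int 1 - int (m ^ (p ^ a))"
    using u(1) by (simp only: int_pow_eq)
  moreover have "int p dvd int (ord u)" using j \<open>j \<noteq> 0\<close> by simp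
  ultimately have "int p dvd int 1 - int (m ^ (p ^ a))" by (rule dvd_trans[rotated])
  then have "[int 1 = int (m ^ (p ^ a))] (mod int p)" by (simp only: cong_iff_dvd_diff)
  then have "[1 = m ^ (p ^ a)] (mod p)" by (simp only: cong_int_iff)
  then show ?thesis
    using prime_power_pow_cong[OF p, of m a] cong_sym cong_trans by blast
qed

section \<open>The transfer into an abelian group\<close>

text \<open>In the quotient by \<open>B\<close> all factors equal \<open>a\<close>, so the product is \<open>a\<close> to the number of factors.\<close>

lemma (in comm_group) finprod_near_constant:
  assumes B: "subgroup B G" and "finite S" "a \<in> carrier G" "f \<in> S \<rightarrow> carrier G"
    and near: "\<And>x. x \<in> S \<Longrightarrow> inv a \<otimes> f x \<in> B" and pow: "a [^] card S \<in> B"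
  shows "finprod G f S \<in> B"
proof -
  have "a \<otimes> (inv a \<otimes> f x) = f x" if "x \<in> S" for x
    using that assms(3,4) by (simp add: m_assoc[symmetric] Pi_iff)
  then have "finprod G f S = (\<Otimes>x\<in>S. a \<otimes> (inv a \<otimes> f x))"
    using assms(4) by (intro finprod_cong') auto
  also have "\<dots> = a [^] card S \<otimes> (\<Otimes>x\<in>S. inv a \<otimes> f x)"
    using assms(3,4) by (subst finprod_multf) (auto simp: finprod_const)
  also have "\<dots> \<in> B"
    by (intro subgroup.m_closed[OF B] pow finprod_in_subgroup[OF B \<open>finite S\<close>] near)
  finally show ?thesis .
qed

locale transfer_setup = group G + A: comm_group A
  for G (structure) and A (structure) +
  fixes N :: "'a set" and \<phi> :: "'a \<Rightarrow> 'c"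
  assumes finite_G: "finite (carrier G)"
    and N: "subgroup N G"
    and \<phi>_hom: "\<phi> \<in> hom (G\<lparr>carrier := N\<rparr>) A"
begin

lemma N_closed [simp]: "x \<in> N \<Longrightarrow> x \<in> carrier G"
  by (rule subgroup.mem_carrier[OF N])

lemma N_mult [simp]: "x \<in> N \<Longrightarrow> y \<in> N \<Longrightarrow> x \<otimes> y \<in> N"
  by (rule subgroup.m_closed[OF N])

lemma N_inv [simp]: "x \<in> N \<Longrightarrow> inv x \<in> N"
  by (rule subgroup.m_inv_closed[OF N])

lemma N_pow [simp]: "x \<in> N \<Longrightarrow> x [^] (i::nat) \<in> N"
  by (induction i) (simp_all add: subgroup.one_closed[OF N])

lemma \<phi>_closed [simp]: "x \<in> N \<Longrightarrow> \<phi> x \<in> carrier A"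
  using \<phi>_hom by (auto simp: hom_def)

lemma \<phi>_mult [simp]: "x \<in> N \<Longrightarrow> y \<in> N \<Longrightarrow> \<phi> (x \<otimes> y) = \<phi> x \<otimes>\<^bsub>A\<^esub> \<phi> y"
  using \<phi>_hom by (auto simp: hom_def)

lemma \<phi>_one [simp]: "\<phi> \<one> = \<one>\<^bsub>A\<^esub>"
  using \<phi>_mult[of \<one> \<one>] \<phi>_closed[of \<one>] subgroup.one_closed[OF N] by (metis A.l_cancel_one A.r_one l_one one_closed)

lemma \<phi>_pow [simp]: "x \<in> N \<Longrightarrow> \<phi> (x [^] (i::nat)) = \<phi> x [^]\<^bsub>A\<^esub> i"
  by (induction i) simp_all

lemma \<phi>_conj:
  assumes "n \<in> N" "x \<in> N"
  shows "\<phi> (n \<otimes> x \<otimes> inv n) = \<phi> x"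
proof -
  have "\<phi> (n \<otimes> x \<otimes> inv n) = \<phi> x \<otimes>\<^bsub>A\<^esub> (\<phi> n \<otimes>\<^bsub>A\<^esub> \<phi> (inv n))"
    using assms by (simp add: A.m_ac)
  also have "\<phi> n \<otimes>\<^bsub>A\<^esub> \<phi> (inv n) = \<phi> (n \<otimes> inv n)"
    using assms by (intro \<phi>_mult[symmetric]) auto
  finally show ?thesis using assms by simp
qed

lemma finite_rcosets [simp]: "finite (rcosets N)"
  using finite_G by (simp add: RCOSETS_def)

lemma rcosets_translate [simp]:
  assumes "c \<in> rcosets N" "g \<in> carrier G"
  shows "c #> g \<in> rcosets N"
proof -
  obtain x where "x \<in> carrier G" "c = N #> x" using assms(1) by (auto simp: RCOSETS_def)
  then have "c #> g = N #> (x \<otimes> g)"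
    using assms(2) N by (simp add: coset_mult_assoc subgroup.subset)
  then show ?thesis
    using \<open>x \<in> carrier G\<close> assms(2) by (auto simp: RCOSETS_def)
qed

lemma rcosets_sub: "c \<in> rcosets N \<Longrightarrow> c \<subseteq> carrier G"
  using subgroup.rcosets_carrier[OF N is_group] by blast

lemma rcosets_assoc:
  "\<lbrakk>c \<in> rcosets N; g \<in> carrier G; h \<in> carrier G\<rbrakk> \<Longrightarrow> c #> g #> h = c #> (g \<otimes> h)"
  by (simp add: coset_mult_assoc rcosets_sub)

definition rep :: "'a set \<Rightarrow> 'a"
  where "rep c = (SOME x. x \<in> carrier G \<and> N #> x = c)"

lemma rep:
  assumes "c \<in> rcosets N"
  shows "rep c \<in> carrier G" "N #> rep c = c"
proof -
  have "\<exists>x. x \<in> carrier G \<and> N #> x = c"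
    using assms by (auto simp: RCOSETS_def)
  then have "rep c \<in> carrier G \<and> N #> rep c = c"
    unfolding rep_def by (rule someI_ex)
  then show "rep c \<in> carrier G" "N #> rep c = c" by auto
qed

lemma same_coset_quotient:
  assumes "x \<in> carrier G" "y \<in> carrier G" "N #> x = N #> y"
  shows "x \<otimes> inv y \<in> N"
  using assms N by (metis repr_independenceD subgroup.rcos_module_imp is_group)

text \<open>The element of \<open>N\<close> that measures how far \<open>g\<close> is from permuting the chosen representatives:
\<open>rep c \<otimes> g = factor g c \<otimes> rep (c #> g)\<close>.\<close>

definition factor :: "'a \<Rightarrow> 'a set \<Rightarrow> 'a"
  where "factor g c = rep c \<otimes> g \<otimes> inv (rep (c #> g))"

lemma factor_in_N [simp]:
  assumes "c \<in> rcosets N" "g \<in> carrier G"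
  shows "factor g c \<in> N"
  unfolding factor_def using assms N
  by (intro same_coset_quotient)
     (simp_all add: rep coset_mult_assoc[symmetric] subgroup.subset)

text \<open>This cocycle identity is what makes the transfer multiplicative.\<close>

lemma factor_mult:
  assumes "c \<in> rcosets N" "g \<in> carrier G" "h \<in> carrier G"
  shows "factor (g \<otimes> h) c = factor g c \<otimes> factor h (c #> g)"
proof -
  have "inv (rep (c #> g)) \<otimes> (rep (c #> g) \<otimes> y) = y" if "y \<in> carrier G" for y
    using that assms rep by (simp add: m_assoc[symmetric])
  then show ?thesis
    using assms by (simp add: factor_def rep m_assoc rcosets_assoc)
qed

definition transfer :: "'a \<Rightarrow> 'c"
  where "transfer g = (\<Otimes>\<^bsub>A\<^esub>c\<in>rcosets N. \<phi> (factor g c))"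

lemma bij_translate:
  assumes "g \<in> carrier G"
  shows "inj_on (\<lambda>c. c #> g) (rcosets N)" "(\<lambda>c. c #> g) ` (rcosets N) = rcosets N"
proof -
  have cancel: "c #> g #> inv g = c" "c #> inv g #> g = c" if "c \<in> rcosets N" for c
    using that assms by (simp_all add: rcosets_assoc coset_mult_one rcosets_sub)
  show "inj_on (\<lambda>c. c #> g) (rcosets N)"
    by (rule inj_on_inverseI[where g = "\<lambda>c. c #> inv g"]) (rule cancel(1))
  have "c \<in> (\<lambda>c. c #> g) ` (rcosets N)" if c: "c \<in> rcosets N" for c
    using c assms by (intro image_eqI[where x = "c #> inv g"]) (simp_all add: cancel)
  then show "(\<lambda>c. c #> g) ` (rcosets N) = rcosets N"
    using assms by auto
qed

lemma transfer_hom: "transfer \<in> hom G A"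
proof (rule homI)
  show "transfer g \<in> carrier A" if "g \<in> carrier G" for g
    using that unfolding transfer_def by (intro A.finprod_closed) auto
  fix g h assume g: "g \<in> carrier G" and h: "h \<in> carrier G"
  have "transfer (g \<otimes> h) =
      (\<Otimes>\<^bsub>A\<^esub>c\<in>rcosets N. \<phi> (factor g c) \<otimes>\<^bsub>A\<^esub> \<phi> (factor h (c #> g)))"
    unfolding transfer_def using g h
    by (intro A.finprod_cong') (auto simp: factor_mult)
  also have "\<dots> = transfer g \<otimes>\<^bsub>A\<^esub> (\<Otimes>\<^bsub>A\<^esub>c\<in>rcosets N. \<phi> (factor h (c #> g)))"
    unfolding transfer_def using g h by (intro A.finprod_multf) auto
  also have "(\<Otimes>\<^bsub>A\<^esub>c\<in>rcosets N. \<phi> (factor h (c #> g))) = transfer h"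
    unfolding transfer_def using g h bij_translate[OF g]
    by (subst A.finprod_reindex[symmetric]) auto
  finally show "transfer (g \<otimes> h) = transfer g \<otimes>\<^bsub>A\<^esub> transfer h" .
qed

text \<open>The representatives of intermediate cosets telescope away.\<close>

lemma finprod_factor_powers:
  assumes "c \<in> rcosets N" "u \<in> carrier G"
  shows "(\<Otimes>\<^bsub>A\<^esub>i\<in>{..<j}. \<phi> (factor u (c #> u [^] i))) = \<phi> (factor (u [^] (j::nat)) c)"
proof (induction j)
  case 0
  then show ?case
    using assms by (simp add: factor_def rep coset_mult_one rcosets_sub)
next
  case (Suc j)
  have "factor (u [^] Suc j) c = factor (u [^] j) c \<otimes> factor u (c #> u [^] j)"
    using assms by (simp add: factor_mult)
  then show ?case
    using assms Suc by (subst lessThan_Suc, subst A.finprod_insert) (auto simp: A.m_comm)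
qed

text \<open>The orbit of \<open>c\<close> closes up after \<open>n\<close> steps, where \<open>n\<close> is the least positive number with
\<open>c #> u\<^sup>n = c\<close>; the telescoping product over one period then starts and ends at the same representative.\<close>

lemma cyclic_orbit_product:
  assumes c: "c \<in> rcosets N" and u: "u \<in> carrier G"
  defines "S \<equiv> (\<lambda>l. c #> l) ` generate G {u}"
  obtains n :: nat where "card S = n" "c #> u [^] n = c"
    "finprod A (\<lambda>d. \<phi> (factor u d)) S = \<phi> (rep c \<otimes> u [^] n \<otimes> inv (rep c))"
proof -
  have add: "c #> u [^] i #> u [^] j = c #> u [^] (i + j)" for i j :: nat
    using c u by (simp add: rcosets_assoc nat_pow_mult)
  have one: "c #> \<one> = c" using c by (simp add: coset_mult_one rcosets_sub)
  define Q where "Q n \<longleftrightarrow> n > 0 \<and> c #> u [^] n = c" for n :: nat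
  define n where "n = (LEAST n. Q n)"
  have "Q (order G)"
    using finite_G u one by (simp add: Q_def pow_order_eq_1 order_gt_0_iff_finite)
  then have "Q n" unfolding n_def by (rule LeastI)
  then have n: "n > 0" "c #> u [^] n = c" by (auto simp: Q_def)
  have least: "\<not> Q i" if "i < n" for i using that not_less_Least unfolding n_def by blast
  have mult: "c #> u [^] (n * q) = c" for q
    by (induction q) (simp_all add: one n add[symmetric])
  have image: "S = (\<lambda>i. c #> u [^] i) ` {..<n}"
  proof -
    have "S = range (\<lambda>i::nat. c #> u [^] i)"
      unfolding S_def generate_pow_on_finite_carrier[OF finite_G u] by auto
    moreover have "c #> u [^] i = c #> u [^] (i mod n)" for i :: nat
      using add[of "n * (i div n)" "i mod n"] by (simp add: mult)
    then have "range (\<lambda>i::nat. c #> u [^] i) = (\<lambda>i. c #> u [^] i) ` {..<n}"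
      using n(1) by (auto simp: image_iff intro!: bexI[where x = "_ mod n"])
    ultimately show ?thesis by simp
  qed
  have no_repeat: False if "i < j" "j < n" "c #> u [^] i = c #> u [^] j" for i j :: nat
  proof -
    have "c #> u [^] (j + (n - j)) = c #> u [^] (i + (n - j))"
      by (simp only: add[symmetric] that(3))
    then have "c #> u [^] (i + (n - j)) = c"
      using that n by simp
    moreover have "0 < i + (n - j)" "i + (n - j) < n" using that by auto
    ultimately show False using least unfolding Q_def by blast
  qed
  have inj: "inj_on (\<lambda>i. c #> u [^] i) {..<n}"
  proof (rule inj_onI)
    fix i j assume "i \<in> {..<n}" "j \<in> {..<n}" "c #> u [^] i = c #> u [^] j"
    then show "i = j"
      using no_repeat[of i j] no_repeat[of j i] by (cases i j rule: linorder_cases) auto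
  qed
  have "finprod A (\<lambda>d. \<phi> (factor u d)) S = (\<Otimes>\<^bsub>A\<^esub>i\<in>{..<n}. \<phi> (factor u (c #> u [^] i)))"
    unfolding image using c u inj by (intro A.finprod_reindex) auto
  also have "\<dots> = \<phi> (rep c \<otimes> u [^] n \<otimes> inv (rep c))"
    using c u by (simp only: finprod_factor_powers) (simp add: factor_def n)
  finally have "finprod A (\<lambda>d. \<phi> (factor u d)) S = \<phi> (rep c \<otimes> u [^] n \<otimes> inv (rep c))" .
  moreover have "card S = n" unfolding image using inj by (simp add: card_image)
  ultimately show thesis using n(2) that by blast
qed

section \<open>The transfer of a p-element modulo p-th powers\<close>

lemma fixed_coset:
  assumes "c \<in> rcosets N" "u \<in> carrier G"
  shows "c #> u = c \<longleftrightarrow> rep c \<otimes> u \<otimes> inv (rep c) \<in> N"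
  using coset_translate_fixed_iff[OF N rep(1)[OF assms(1)] assms(2)] rep(2)[OF assms(1)] by simp

text \<open>The representative of \<open>c #> k\<close> is \<open>rep c \<otimes> k\<close> up to a factor from \<open>N\<close>, and \<open>\<phi>\<close> is invariant
under conjugation by that factor. So the contribution of \<open>c #> k\<close> is that of \<open>c\<close> with \<open>u\<close> replaced by \<open>k u k\<^sup>-\<^sup>1\<close>.\<close>

lemma factor_fixed_translate:
  assumes c: "c \<in> rcosets N" "c #> u = c" and u: "u \<in> carrier G"
    and k: "k \<in> carrier G" "k \<otimes> u \<otimes> inv k = u [^] (m::nat)"
  shows "c #> k #> u = c #> k"
    and "\<phi> (factor u (c #> k)) = \<phi> (factor u c) [^]\<^bsub>A\<^esub> m"
proof -
  define x where "x = rep c \<otimes> u \<otimes> inv (rep c)"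
  have x: "x \<in> N" using c u by (simp add: x_def fixed_coset[symmetric])
  have fix_pow: "c #> u [^] (i::nat) = c" for i
  proof (induction i)
    case 0
    then show ?case using c by (simp add: coset_mult_one rcosets_sub)
  next
    case (Suc i)
    then show ?case using c u by (simp add: rcosets_assoc[symmetric])
  qed
  have ku: "k \<otimes> u = u [^] m \<otimes> k"
    using k u by (metis inv_solve_right m_closed nat_pow_closed)
  have "c #> k #> u = c #> u [^] m #> k"
    using c(1) u k(1) by (simp add: rcosets_assoc ku)
  then show fixed: "c #> k #> u = c #> k" by (simp add: fix_pow)
  let ?d = "c #> k"
  have d: "?d \<in> rcosets N" using c k by simp
  define n where "n = rep ?d \<otimes> inv (rep c \<otimes> k)"
  have rc: "rep c \<in> carrier G" "rep ?d \<in> carrier G" using c d rep by auto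
  have "N #> (rep c \<otimes> k) = c #> k"
    using c k rc rep(2)[OF c(1)] N
    by (metis coset_mult_assoc subgroup.subset)
  then have n: "n \<in> N"
    unfolding n_def using rc k rep(2)[OF d] by (intro same_coset_quotient) auto
  have "rep ?d = n \<otimes> (rep c \<otimes> k)"
    using rc k by (simp add: n_def inv_solve_right m_assoc)
  then have "factor u ?d = n \<otimes> (rep c \<otimes> k) \<otimes> u \<otimes> inv (n \<otimes> (rep c \<otimes> k))"
    by (simp add: factor_def fixed)
  also have "\<dots> = n \<otimes> (rep c \<otimes> (k \<otimes> u \<otimes> inv k) \<otimes> inv (rep c)) \<otimes> inv n"
    using n rc(1) k(1) u by (simp add: inv_mult_group m_assoc)
  also have "\<dots> = n \<otimes> x [^] m \<otimes> inv n"
    using rc(1) u by (simp add: k(2) pow_conj x_def)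
  finally have "\<phi> (factor u ?d) = \<phi> x [^]\<^bsub>A\<^esub> m"
    using n x by (simp only: \<phi>_conj N_pow \<phi>_pow)
  then show "\<phi> (factor u (c #> k)) = \<phi> (factor u c) [^]\<^bsub>A\<^esub> m"
    by (simp add: factor_def c x_def)
qed

text \<open>The step of the induction on the order of \<open>u\<close>: modulo \<open>B\<close>, only the coset \<open>N\<close> contributes to the
transfer of \<open>u\<close>. The cosets moved by \<open>u\<close> are collected in \<open>M\<close> and treated along the orbits of \<open>u\<close>; the other
cosets fixed by \<open>u\<close> are collected in \<open>F\<close> and treated along the orbits of \<open>K\<close>.\<close>

theorem transfer_congruence:
  assumes p: "Factorial_Ring.prime p"
    and B: "subgroup B A" and B_pow: "\<And>a. a \<in> carrier A \<Longrightarrow> a [^]\<^bsub>A\<^esub> p \<in> B"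
    and u: "u \<in> N" "u [^] (p ^ Suc e) = \<one>"
    and K: "subgroup K G" "K \<subseteq> N" "card K = p ^ a"
    and normalizes: "\<And>k. k \<in> K \<Longrightarrow> \<exists>m::nat. k \<otimes> u \<otimes> inv k = u [^] m"
    and only: "\<And>c. c \<in> rcosets N \<Longrightarrow> \<forall>k\<in>K. c #> k = c \<Longrightarrow> c = N"
    and small: "\<And>x. x \<in> N \<Longrightarrow> x [^] (p ^ e) = \<one> \<Longrightarrow> \<phi> x \<in> B"
  shows "inv\<^bsub>A\<^esub> (\<phi> u) \<otimes>\<^bsub>A\<^esub> transfer u \<in> B"
proof -
  define f where "f = (\<lambda>c. \<phi> (factor u c))"
  define M where "M = {c \<in> rcosets N. c #> u \<noteq> c}"
  define F where "F = {c \<in> rcosets N. c #> u = c \<and> c \<noteq> N}"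
  have uG: "u \<in> carrier G" using u(1) by simp
  have f_closed: "f c \<in> carrier A" if "c \<in> rcosets N" for c
    using that uG by (simp add: f_def)
  have N_coset: "N \<in> rcosets N"
    using subgroup.subgroup_in_rcosets[OF N is_group] .
  have N_fixed: "N #> n = N" if "n \<in> N" for n
    using that N by (simp add: coset_join2)
  have B_pow_dvd: "b [^]\<^bsub>A\<^esub> (j::nat) \<in> B" if "b \<in> carrier A" "p dvd j" for b j
  proof -
    obtain q where "j = q * p" using \<open>p dvd j\<close> by (metis dvdE mult.commute)
    then show ?thesis
      using B_pow[of "b [^]\<^bsub>A\<^esub> q"] that(1) by (simp add: A.nat_pow_pow)
  qed
  have K_pow: "k [^] (p ^ a) = \<one>" if "k \<in> K" for k
  proof -
    interpret K: group "G\<lparr>carrier := K\<rparr>" using K(1) by (rule subgroup_imp_group)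
    show ?thesis
      using K.pow_order_eq_1[of k] that K(3) by (simp add: order_def nat_pow_consistent[symmetric])
  qed

  have fN: "f N = \<phi> u"
  proof -
    have "rep N \<in> N"
      using rep[OF N_coset] N by (metis coset_join1)
    then show ?thesis
      using u(1) by (simp add: f_def factor_def N_fixed \<phi>_conj del: \<phi>_mult)
  qed

  have M_in_B: "finprod A f M \<in> B"
  proof -
    let ?U = "generate G {u}"
    have U: "subgroup ?U G" using uG by (simp add: generate_is_subgroup)
    have U_elem: "\<exists>i::nat. l = u [^] i" if "l \<in> ?U" for l
      using that generate_pow_on_finite_carrier[OF finite_G uG] by auto
    interpret M: right_translations G ?U M
    proof (intro right_translations.intro right_translations_axioms.intro is_group U)
      show "c \<subseteq> carrier G" if "c \<in> M" for c
        using that rcosets_sub by (auto simp: M_def)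
      show "c #> l \<in> M" if "c \<in> M" "l \<in> ?U" for c l
      proof -
        have c: "c \<in> rcosets N" "c #> u \<noteq> c" using that(1) by (auto simp: M_def)
        obtain i :: nat where i: "l = u [^] i" using U_elem \<open>l \<in> ?U\<close> by blast
        have "c #> u = c" if "c #> l #> u = c #> l"
        proof -
          have l: "l \<in> carrier G" using i uG by simp
          have "u \<otimes> l = l \<otimes> u" using uG by (simp add: i nat_pow_Suc2[symmetric])
          \<comment> \<open>Since \<open>l\<close> commutes with \<open>u\<close>, a coset in the orbit can be fixed by \<open>u\<close> only if \<open>c\<close> is.\<close>
          have "c #> u = c #> u #> l #> inv l"
            using c(1) uG l by (simp add: rcosets_assoc coset_mult_one rcosets_sub m_assoc)
          also have "c #> u #> l = c #> l"
            using c(1) uG l that by (simp add: rcosets_assoc \<open>u \<otimes> l = l \<otimes> u\<close>)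
          also have "c #> l #> inv l = c"
            using c(1) l by (simp add: rcosets_assoc coset_mult_one rcosets_sub)
          finally show ?thesis .
        qed
        then show ?thesis using c uG i by (auto simp: M_def)
      qed
    qed
    have card_U: "\<exists>j. card ?U = p ^ j"
      using u(2) uG pow_eq_id divides_primepow_nat[OF p] generate_pow_card by metis
    show ?thesis
    proof (rule M.finprod_by_orbits[OF A.comm_group_axioms B])
      show "finite M" by (simp add: M_def)
      show "f \<in> M \<rightarrow> carrier A" by (auto simp: M_def f_closed)
      show "finprod A f (M.orb c) \<in> B" if "c \<in> M" for c
      proof -
        have c: "c \<in> rcosets N" "c #> u \<noteq> c" using that by (auto simp: M_def)
        obtain n :: nat where n: "card (M.orb c) = n" "c #> u [^] n = c"
          "finprod A f (M.orb c) = \<phi> (rep c \<otimes> u [^] n \<otimes> inv (rep c))"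
          unfolding f_def M.orb_def using cyclic_orbit_product[OF c(1) uG] by metis
        have "u \<in> ?U" by (simp add: generate.incl)
        \<comment> \<open>This makes the \<open>n\<close>-th power of \<open>u\<close> an element whose order divides \<open>p ^ e\<close>.\<close>
        then have "p dvd n"
          using M.prime_dvd_card_orb[OF p _ that] card_U c(2) n(1) by metis
        then obtain q where q: "n = p * q" by blast
        let ?x = "rep c \<otimes> u [^] n \<otimes> inv (rep c)"
        have "?x \<in> N" using n(2) c(1) uG by (simp add: fixed_coset[symmetric])
        moreover have "?x [^] (p ^ e) = \<one>"
        proof -
          have "(u [^] n) [^] (p ^ e) = (u [^] (p ^ Suc e)) [^] q"
            using uG by (simp add: nat_pow_pow q ac_simps)
          also have "\<dots> = \<one>" unfolding u(2) by simp
          finally show ?thesis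
            using rep(1)[OF c(1)] uG by (simp add: pow_conj[symmetric])
        qed
        ultimately show ?thesis unfolding n(3) by (rule small)
      qed
    qed
  qed

  have F_in_B: "finprod A f F \<in> B"
  proof -
    have K_closed: "k \<in> carrier G" "k \<in> N" if "k \<in> K" for k
      using that K(2) by auto
    interpret F: right_translations G K F
    proof (intro right_translations.intro right_translations_axioms.intro is_group K(1))
      show "c \<subseteq> carrier G" if "c \<in> F" for c
        using that rcosets_sub by (auto simp: F_def)
      show "c #> k \<in> F" if "c \<in> F" "k \<in> K" for c k
      proof -
        have c: "c \<in> rcosets N" "c #> u = c" "c \<noteq> N" using that(1) by (auto simp: F_def)
        obtain m :: nat where "k \<otimes> u \<otimes> inv k = u [^] m"
          using normalizes[OF \<open>k \<in> K\<close>] by blast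
        then have "c #> k #> u = c #> k"
          using factor_fixed_translate(1)[OF c(1,2) uG] K_closed \<open>k \<in> K\<close> by blast
        moreover have "c #> k \<noteq> N"
        proof
          \<comment> \<open>\<open>N\<close> is its own \<open>K\<close>-orbit, because \<open>K\<close> lies in \<open>N\<close>.\<close>
          assume "c #> k = N"
          moreover have "c = c #> k #> inv k"
            using c(1) K_closed[OF \<open>k \<in> K\<close>] by (simp add: rcosets_assoc coset_mult_one rcosets_sub)
          ultimately show False
            using c(3) N_fixed[of "inv k"] K_closed[OF \<open>k \<in> K\<close>] by simp
        qed
        ultimately show ?thesis
          using c(1) K_closed[OF \<open>k \<in> K\<close>] by (simp add: F_def)
      qed
    qed
    show ?thesis
    proof (rule F.finprod_by_orbits[OF A.comm_group_axioms B])
      show "finite F" by (simp add: F_def)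
      show "f \<in> F \<rightarrow> carrier A" by (auto simp: F_def f_closed)
      show "finprod A f (F.orb c) \<in> B" if "c \<in> F" for c
      proof (rule A.finprod_near_constant[OF B, where a = "f c"])
        have c: "c \<in> rcosets N" "c #> u = c" "c \<noteq> N" using that by (auto simp: F_def)
        show "f c \<in> carrier A" using c(1) by (rule f_closed)
        show "finite (F.orb c)"
          using finite_subset[OF F.orb_subset[OF that]] by (simp add: F_def)
        show "f \<in> F.orb c \<rightarrow> carrier A"
          using F.orb_subset[OF that] f_closed by (auto simp: F_def)
        obtain k where "k \<in> K" "c #> k \<noteq> c" using only c(1,3) by blast
        then have "p dvd card (F.orb c)"
          using F.prime_dvd_card_orb[OF p K(3) that] by blast
        then show "f c [^]\<^bsub>A\<^esub> card (F.orb c) \<in> B"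
          using B_pow_dvd f_closed[OF c(1)] by blast
        show "inv\<^bsub>A\<^esub> f c \<otimes>\<^bsub>A\<^esub> f d \<in> B" if "d \<in> F.orb c" for d
        proof -
          obtain k where k: "k \<in> K" "d = c #> k"
            using \<open>d \<in> F.orb c\<close> by (auto simp: F.orb_def)
          obtain m :: nat where m: "k \<otimes> u \<otimes> inv k = u [^] m"
            using normalizes[OF \<open>k \<in> K\<close>] by blast
          have fd: "f d = f c [^]\<^bsub>A\<^esub> m"
            unfolding f_def k(2)
            by (rule factor_fixed_translate(2)[OF c(1,2) uG K_closed(1)[OF k(1)] m])
          show ?thesis
          \<comment> \<open>For \<open>u = \<one>\<close> the exponent \<open>m\<close> is arbitrary, so this case is separate.\<close>
          proof (cases "u = \<one>")
            case True
            then have "f c = \<one>\<^bsub>A\<^esub>"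
              using c rep(1)[OF c(1)] by (simp add: f_def factor_def)
            then show ?thesis using fd subgroup.one_closed[OF B] by simp
          next
            case False
            have "[m = 1] (mod p)"
              using power_automorphism_exponent[OF p uG False u(2) K_closed(1)[OF k(1)] K_pow[OF k(1)] m] .
            then have "m mod p = 1"
              using prime_gt_1_nat[OF p] by (simp add: cong_def)
            then have "m = 1 + p * (m div p)"
              by (metis mod_mult_div_eq)
            then obtain q where "m = 1 + p * q" by blast
            then have "f d = f c \<otimes>\<^bsub>A\<^esub> f c [^]\<^bsub>A\<^esub> (p * q)"
              using f_closed[OF c(1)] fd by (simp add: A.m_comm)
            then have "inv\<^bsub>A\<^esub> f c \<otimes>\<^bsub>A\<^esub> f d = f c [^]\<^bsub>A\<^esub> (p * q)"
              using f_closed[OF c(1)] by (simp add: A.m_assoc[symmetric])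
            then show ?thesis
              using B_pow_dvd[OF f_closed[OF c(1)], of "p * q"] by simp
          qed
        qed
      qed
    qed
  qed

  have "rcosets N = insert N (F \<union> M)"
    using N_coset N_fixed[OF u(1)] by (auto simp: F_def M_def)
  moreover have "finite F" "finite M" "F \<inter> M = {}" "N \<notin> F \<union> M"
    using N_fixed[OF u(1)] by (auto simp: F_def M_def)
  moreover have "f \<in> F \<rightarrow> carrier A" "f \<in> M \<rightarrow> carrier A" "f \<in> F \<union> M \<rightarrow> carrier A"
    by (auto simp: F_def M_def f_closed)
  ultimately have "transfer u = f N \<otimes>\<^bsub>A\<^esub> (finprod A f F \<otimes>\<^bsub>A\<^esub> finprod A f M)"
    unfolding transfer_def f_def[symmetric]
    using f_closed[OF N_coset] by (simp add: A.finprod_insert A.finprod_Un_disjoint)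
  moreover have "finprod A f F \<otimes>\<^bsub>A\<^esub> finprod A f M \<in> B"
    using F_in_B M_in_B by (rule subgroup.m_closed[OF B])
  moreover have "inv\<^bsub>A\<^esub> a \<otimes>\<^bsub>A\<^esub> (a \<otimes>\<^bsub>A\<^esub> b) = b" if "a \<in> carrier A" "b \<in> B" for a b
    using that subgroup.mem_carrier[OF B] by (simp add: A.m_assoc[symmetric])
  ultimately show ?thesis using u(1) by (simp add: fN)
qed

section \<open>Surjectivity of the transfer\<close>

text \<open>The subgroup \<open>B\<close> plays the role of a Frattini subgroup enlarged by the image of the transfer:
once \<open>B\<close> is all of \<open>A\<close>, repeatedly rewriting the \<open>p\<close>-th powers shows that every element of \<open>A\<close> lies in the
image up to a \<open>p\<^sup>i\<close>-th power, and for \<open>p\<^sup>i = |A|\<close> that power is trivial.\<close>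

theorem transfer_surjective:
  assumes p: "Factorial_Ring.prime p" and A: "order A = p ^ b" "\<phi> ` N = carrier A"
    and P: "subgroup P G" "P \<subseteq> N" "card P = p ^ a"
    and card_N: "card N = card P * r" "\<not> p dvd r"
    and K: "subgroup K G" "K \<subseteq> P" "card K = p ^ d"
    and normalizes: "\<And>k u. k \<in> K \<Longrightarrow> u \<in> P \<Longrightarrow> \<exists>m::nat. k \<otimes> u \<otimes> inv k = u [^] m"
    and only: "\<And>c. c \<in> rcosets N \<Longrightarrow> \<forall>k\<in>K. c #> k = c \<Longrightarrow> c = N"
  shows "transfer ` carrier G = carrier A"
proof -
  interpret V: group_hom G A transfer
    using transfer_hom by unfold_locales
  define H where "H = transfer ` carrier G"
  have H: "subgroup H A" unfolding H_def by (rule V.img_is_subgroup)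
  have H_mem [simp]: "h \<in> carrier A" if "h \<in> H" for h
    using that subgroup.mem_carrier[OF H] by blast
  define B where "B = {h \<otimes>\<^bsub>A\<^esub> x [^]\<^bsub>A\<^esub> p | h x. h \<in> H \<and> x \<in> carrier A}"
  have BI: "h \<otimes>\<^bsub>A\<^esub> x [^]\<^bsub>A\<^esub> p \<in> B" if "h \<in> H" "x \<in> carrier A" for h x
    using that by (auto simp: B_def)
  have B: "subgroup B A"
  proof (rule A.subgroupI)
    show "B \<subseteq> carrier A" by (auto simp: B_def)
    show "B \<noteq> {}" using BI subgroup.one_closed[OF H] by blast
    fix b assume "b \<in> B"
    then obtain h x where b: "h \<in> H" "x \<in> carrier A" "b = h \<otimes>\<^bsub>A\<^esub> x [^]\<^bsub>A\<^esub> p"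
      by (auto simp: B_def)
    have "inv\<^bsub>A\<^esub> b = inv\<^bsub>A\<^esub> h \<otimes>\<^bsub>A\<^esub> (inv\<^bsub>A\<^esub> x) [^]\<^bsub>A\<^esub> p"
      using b by (simp add: A.inv_mult A.nat_pow_inv)
    then show "inv\<^bsub>A\<^esub> b \<in> B"
      using BI[of "inv\<^bsub>A\<^esub> h" "inv\<^bsub>A\<^esub> x"] b subgroup.m_inv_closed[OF H] by simp
    fix b' assume "b' \<in> B"
    then obtain h' x' where b': "h' \<in> H" "x' \<in> carrier A" "b' = h' \<otimes>\<^bsub>A\<^esub> x' [^]\<^bsub>A\<^esub> p"
      by (auto simp: B_def)
    have "b \<otimes>\<^bsub>A\<^esub> b' = (h \<otimes>\<^bsub>A\<^esub> h') \<otimes>\<^bsub>A\<^esub> (x \<otimes>\<^bsub>A\<^esub> x') [^]\<^bsub>A\<^esub> p"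
      using b b' by (simp add: A.nat_pow_distrib A.m_ac)
    then show "b \<otimes>\<^bsub>A\<^esub> b' \<in> B"
      using BI[of "h \<otimes>\<^bsub>A\<^esub> h'" "x \<otimes>\<^bsub>A\<^esub> x'"] b b' subgroup.m_closed[OF H] by simp
  qed
  have H_B: "h \<in> B" if "h \<in> H" for h
    using BI[OF that A.one_closed] that by simp
  have pow_B: "x [^]\<^bsub>A\<^esub> p \<in> B" if "x \<in> carrier A" for x
    using BI[OF subgroup.one_closed[OF H] that] that by simp

  have "\<forall>u\<in>N. u [^] (p ^ e) = \<one> \<longrightarrow> \<phi> u \<in> B" for e
  proof (induction e)
    case 0
    then show ?case using subgroup.one_closed[OF B] by simp
  next
    case (Suc e)
    show ?case
    proof (intro ballI impI)
      fix u assume u: "u \<in> N" "u [^] (p ^ Suc e) = \<one>"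
      have uG: "u \<in> carrier G" using u by simp
      obtain j where j: "card (generate G {u}) = p ^ j"
        using card_generate_p_element[OF p uG u(2)] by blast
      have U: "subgroup (generate G {u}) G" using uG by (simp add: generate_is_subgroup)
      have "generate G {u} \<subseteq> N"
        using u(1) by (auto simp: generate_pow_on_finite_carrier[OF finite_G uG])
      then have "\<exists>n\<in>N. \<forall>q\<in>generate G {u}. (n \<otimes> \<one>) \<otimes> q \<otimes> inv (n \<otimes> \<one>) \<in> P"
        by (intro p_subgroup_conj_into_sylow[OF finite_G p P(1) N P(2) card_N U j one_closed]) auto
      then obtain n where n: "n \<in> N" "n \<otimes> u \<otimes> inv n \<in> P"
        using generate.incl[of u "{u}" G] by auto
      define v where "v = n \<otimes> u \<otimes> inv n"
      have v: "v \<in> P" "v \<in> N" using n P(2) by (auto simp: v_def)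
      have v_pow: "v [^] (p ^ Suc e) = \<one>"
        using n(1) uG by (simp only: v_def pow_conj[symmetric] N_closed u(2)) simp
      have congr: "inv\<^bsub>A\<^esub> (\<phi> v) \<otimes>\<^bsub>A\<^esub> transfer v \<in> B"
      proof (rule transfer_congruence[OF p B pow_B v(2) v_pow K(1) _ K(3)])
        show "K \<subseteq> N" using K(2) P(2) by (rule subset_trans)
        show "\<exists>m::nat. k \<otimes> v \<otimes> inv k = v [^] m" if "k \<in> K" for k
          using that v(1) by (rule normalizes)
        show "c = N" if "c \<in> rcosets N" "\<forall>k\<in>K. c #> k = c" for c
          using that by (rule only)
        show "\<phi> x \<in> B" if "x \<in> N" "x [^] (p ^ e) = \<one>" for x
          using that Suc by blast
      qed
      have V: "transfer v \<in> H" "transfer v \<in> carrier A" using v by (auto simp: H_def)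
      have "\<phi> v = transfer v \<otimes>\<^bsub>A\<^esub> inv\<^bsub>A\<^esub> (inv\<^bsub>A\<^esub> (\<phi> v) \<otimes>\<^bsub>A\<^esub> transfer v)"
        using v(2) V(2) by (simp add: A.inv_mult A.m_lcomm)
      also have "\<dots> \<in> B"
        by (rule subgroup.m_closed[OF B H_B[OF V(1)] subgroup.m_inv_closed[OF B congr]])
      finally show "\<phi> u \<in> B"
        using n(1) u(1) by (simp add: v_def \<phi>_conj del: \<phi>_mult)
    qed
  qed
  then have p_elements: "\<phi> u \<in> B" if "u \<in> N" "u [^] (p ^ e) = \<one>" for u e
    using that by blast

  have A_B: "x \<in> B" if x: "x \<in> carrier A" for x
  proof -
    interpret N: group "G\<lparr>carrier := N\<rparr>" using N by (rule subgroup_imp_group)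
    have "subgroup P (G\<lparr>carrier := N\<rparr>)"
      using P(1) N P(2) by (simp add: subgroup_incl)
    then have "\<phi> ` N = \<phi> ` P"
      using N.hom_image_sylow[OF _ p _ P(3) _ card_N(2) A.comm_group_axioms A(1) \<phi>_hom]
        card_N(1) finite_subset[OF subgroup.subset[OF N] finite_G] by (simp add: order_def)
    then obtain u where u: "u \<in> P" "x = \<phi> u" using A(2) x by auto
    interpret P: group "G\<lparr>carrier := P\<rparr>" using P(1) by (rule subgroup_imp_group)
    have "u [^] (p ^ a) = \<one>"
      using P.pow_order_eq_1[of u] u(1) P(3) by (simp add: order_def nat_pow_consistent[symmetric])
    then show ?thesis using u P(2) p_elements by blast
  qed
  have "\<exists>h\<in>H. \<exists>y\<in>carrier A. x = h \<otimes>\<^bsub>A\<^esub> y [^]\<^bsub>A\<^esub> (p ^ i)" if x: "x \<in> carrier A" for x i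
  proof (induction i)
    case 0
    then show ?case
      using x subgroup.one_closed[OF H] by (intro bexI[where x = "\<one>\<^bsub>A\<^esub>"] bexI[where x = x]) auto
  next
    case (Suc i)
    then obtain h y where h: "h \<in> H" and y: "y \<in> carrier A" "x = h \<otimes>\<^bsub>A\<^esub> y [^]\<^bsub>A\<^esub> (p ^ i)" by blast
    obtain h' z where h': "h' \<in> H" and z: "z \<in> carrier A" "y = h' \<otimes>\<^bsub>A\<^esub> z [^]\<^bsub>A\<^esub> p"
      using A_B[OF y(1)] by (auto simp: B_def)
    have "x = (h \<otimes>\<^bsub>A\<^esub> h' [^]\<^bsub>A\<^esub> (p ^ i)) \<otimes>\<^bsub>A\<^esub> z [^]\<^bsub>A\<^esub> (p ^ Suc i)"
      using h h' z y(2) by (simp add: A.nat_pow_distrib A.nat_pow_pow A.m_assoc)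
    moreover have "h' [^]\<^bsub>A\<^esub> j \<in> H" for j :: nat
      by (induction j) (use h' subgroup.one_closed[OF H] subgroup.m_closed[OF H] in auto)
    then have "h \<otimes>\<^bsub>A\<^esub> h' [^]\<^bsub>A\<^esub> (p ^ i) \<in> H"
      using h subgroup.m_closed[OF H] by simp
    ultimately show ?case using z(1) by blast
  qed
  then have "x \<in> H" if "x \<in> carrier A" for x
    using that A.pow_order_eq_1 A(1) by (metis A.r_one H_mem)
  then show ?thesis using H_mem unfolding H_def by blast
qed

end

section \<open>Maximal abelian p-quotients\<close>

lemma (in group) A_p_subset_kernel:
  assumes "finite (carrier G)" "Factorial_Ring.prime p"
    and H: "comm_group H" "order H = p ^ n"
    and h: "h \<in> hom G H" "h ` carrier G = carrier H"
  shows "A_p p G \<subseteq> kernel G H h"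
proof (rule A_p_least(4)[OF assms(1,2)])
  interpret H: comm_group H by fact
  interpret h: group_hom G H h using h(1) by unfold_locales
  show normal: "kernel G H h \<lhd> G" by (rule h.normal_kernel)
  have grp: "group (G Mod kernel G H h)" by (rule normal.factorgroup_is_group[OF normal])
  have iso: "G Mod kernel G H h \<cong> H" by (rule h.FactGroup_iso[OF h(2)])
  then show "comm_group (G Mod kernel G H h)"
    using H(1) grp by (metis comm_group.iso_imp_comm_group group.iso_sym group.is_monoid)
  show "p_group p (G Mod kernel G H h)"
    using grp iso_same_card[OF iso] H(2) unfolding p_group_def order_def by metis
qed

lemma (in group_hom) card_image_mult_card_kernel:
  assumes "finite (carrier G)" "h ` carrier G = carrier H"
  shows "order H * card (kernel G H h) = order G"
proof -
  have "order H = card (rcosets\<^bsub>G\<^esub> (kernel G H h))"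
    using iso_same_card[OF FactGroup_iso[OF assms(2)]] by (simp add: order_def FactGroup_def)
  then show ?thesis using G.lagrange[OF subgroup_kernel] by simp
qed

lemma (in normal) card_factor_mult_card:
  "order (G Mod H) * card H = order G"
  using lagrange[OF is_subgroup] by (simp add: order_def FactGroup_def)

text \<open>An epimorphism from \<open>G\<close> to \<open>A\<close> gives \<open>|G / A\<^sup>p(G)| \<ge> |A|\<close>. Conversely \<open>N\<close>, which contains a Sylow
subgroup, maps onto \<open>G / A\<^sup>p(G)\<close>, and this map factors through \<open>A\<close>. So the orders agree, and the kernel of the
epimorphism is no larger than \<open>A\<^sup>p(G)\<close>.\<close>

lemma (in group) A_p_quotients_iso_if_epimorphism:
  assumes fin: "finite (carrier G)" and p: "Factorial_Ring.prime p"
    and P: "subgroup P G" "card P = p ^ a" "order G = card P * r" "\<not> p dvd r"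
    and N: "subgroup N G" "P \<subseteq> N"
  defines "A \<equiv> G\<lparr>carrier := N\<rparr> Mod A_p p (G\<lparr>carrier := N\<rparr>)"
  assumes V: "V \<in> hom G A" "V ` carrier G = carrier A"
  shows "A \<cong> G Mod A_p p G"
proof -
  let ?N = "G\<lparr>carrier := N\<rparr>"
  let ?T = "A_p p G" and ?M = "A_p p ?N"
  interpret N: group ?N using N(1) by (rule subgroup_imp_group)
  have fin_N: "finite (carrier ?N)"
    using fin finite_subset[OF subgroup.subset[OF N(1)]] by simp
  note T = A_p_least[OF fin p] and M = N.A_p_least[OF fin_N p]
  interpret T: normal ?T G by (rule T(1))
  interpret M: normal ?M ?N by (rule M(1))
  interpret Q: comm_group "G Mod ?T" by (rule T(2))
  interpret A: comm_group A unfolding A_def by (rule M(2))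
  obtain b c where b: "order A = p ^ b" and c: "order (G Mod ?T) = p ^ c"
    using T(3) M(3) unfolding p_group_def A_def by blast
  interpret V: group_hom G A V using V(1) by unfold_locales
  have sub: "?T \<subseteq> kernel G A V"
    by (rule A_p_subset_kernel[OF fin p A.comm_group_axioms b V])

  define \<psi> where "\<psi> = (\<lambda>g. ?T #> g)"
  have \<psi>: "\<psi> \<in> hom G (G Mod ?T)" "\<psi> ` carrier G = carrier (G Mod ?T)"
    unfolding \<psi>_def by (rule T.r_coset_hom_Mod, simp add: carrier_FactGroup)
  have "\<psi> ` P \<subseteq> \<psi> ` N" "\<psi> ` N \<subseteq> \<psi> ` carrier G"
    using N(2) subgroup.subset[OF N(1)] by (simp_all add: image_mono)
  then have "\<psi> ` N = carrier (G Mod ?T)"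
    using hom_image_sylow[OF fin p P Q.comm_group_axioms c \<psi>(1)] \<psi>(2) by simp
  then have \<psi>_N: "\<psi> ` carrier ?N = carrier (G Mod ?T)" by simp
  have hom_N: "\<psi> \<in> hom ?N (G Mod ?T)"
    using \<psi>(1) subgroup.mem_carrier[OF N(1)] by (simp add: hom_def Pi_iff)
  interpret \<psi>: group_hom ?N "G Mod ?T" \<psi> using hom_N by unfold_locales
  have "?M \<subseteq> kernel ?N (G Mod ?T) \<psi>"
    by (rule N.A_p_subset_kernel[OF fin_N p Q.comm_group_axioms c hom_N \<psi>_N])
  then have "card ?M \<le> card (kernel ?N (G Mod ?T) \<psi>)"
    using fin_N by (intro card_mono) (auto simp: kernel_def)
  then have "order (G Mod ?T) * card ?M \<le> order (G Mod ?T) * card (kernel ?N (G Mod ?T) \<psi>)"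
    by (rule mult_le_mono2)
  also have "\<dots> = order A * card ?M"
    using \<psi>.card_image_mult_card_kernel[OF fin_N \<psi>_N] M.card_factor_mult_card by (simp add: A_def)
  finally have "order (G Mod ?T) \<le> order A"
    using subgroup.finite_imp_card_positive[OF M.is_subgroup fin_N] by simp
  then have "order (G Mod ?T) * card ?T \<le> order A * card ?T"
    by (rule mult_le_mono1)
  moreover have "order A * card (kernel G A V) = order (G Mod ?T) * card ?T"
    using V.card_image_mult_card_kernel[OF fin V(2)] T.card_factor_mult_card by simp
  ultimately have "order A * card (kernel G A V) \<le> order A * card ?T" by (simp only:)
  moreover have "0 < order A" using b p prime_gt_0_nat by simp
  ultimately have "card (kernel G A V) \<le> card ?T"
    by (simp only: nat_mult_le_cancel1)
  then have "?T = kernel G A V"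
    using sub fin by (intro card_seteq) (auto simp: kernel_def)
  then have "G Mod ?T \<cong> A" using V.FactGroup_iso[OF V(2)] by simp
  then show ?thesis using Q.iso_sym by blast
qed

section \<open>Control of p-transfer by the normalizer\<close>

lemma (in group) mem_normalizer_iff:
  assumes "K \<subseteq> carrier G"
  shows "g \<in> normalizer G K \<longleftrightarrow> g \<in> carrier G \<and> g <# K #> inv g = K"
  using assms by (simp add: normalizer_def stabilizer_def)

lemma (in group) group_norm_normalizes_cyclic:
  assumes P: "subgroup P G" "finite P"
    and k: "k \<in> group_norm (G\<lparr>carrier := P\<rparr>)" "k \<in> P" and u: "u \<in> P"
  shows "\<exists>m::nat. k \<otimes> u \<otimes> inv k = u [^] m"
proof -
  let ?P = "G\<lparr>carrier := P\<rparr>"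
  interpret P: group ?P using P(1) by (rule subgroup_imp_group)
  let ?U = "generate ?P {u}"
  have "subgroup ?U ?P" using u by (intro P.generate_is_subgroup) simp
  then have "k \<in> normalizer ?P ?U" using k(1) by (auto simp: group_norm_def)
  then have "k <#\<^bsub>?P\<^esub> ?U #>\<^bsub>?P\<^esub> inv\<^bsub>?P\<^esub> k = ?U"
    using P.mem_normalizer_iff[of ?U k] subgroup.subset[OF \<open>subgroup ?U ?P\<close>] by blast
  moreover have "u \<in> ?U" by (simp add: generate.incl)
  ultimately have "k \<otimes>\<^bsub>?P\<^esub> u \<otimes>\<^bsub>?P\<^esub> inv\<^bsub>?P\<^esub> k \<in> ?U"
    unfolding l_coset_def r_coset_def by blast
  then have "k \<otimes> u \<otimes> inv k \<in> ?U"
    using P.is_group k(2) P(1) by (simp add: m_inv_consistent)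
  then show ?thesis
    using P.generate_pow_on_finite_carrier[of u] u P(2) by (auto simp: nat_pow_consistent[symmetric])
qed

lemma (in group) mem_conj_set:
  "x \<in> conj_set G K g \<longleftrightarrow> (\<exists>k\<in>K. x = inv g \<otimes> k \<otimes> g)"
  by (auto simp: conj_set_def l_coset_def r_coset_def)

text \<open>What remains is to derive the hypotheses of the surjectivity theorem from the weak closure of \<open>K\<close>: it puts
\<open>P\<close> into the normalizer, and if \<open>K\<close> fixes the coset \<open>N #> t\<close>, then some \<open>h\<close> in \<open>N\<close> makes \<open>h t\<close> conjugate \<open>K\<close>
into \<open>P\<close>, so \<open>h t\<close> normalizes \<open>K\<close> and \<open>t\<close> lies in \<open>N\<close>.\<close>

theorem (in group) normalizer_controls_p_transfer:
  assumes fin: "finite (carrier G)" and p: "Factorial_Ring.prime p"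
    and sylow: "sylow_subgroup p P G"
    and norm: "K \<subseteq> group_norm (G\<lparr>carrier := P\<rparr>)"
    and weakly: "weakly_closed G P K"
  shows "controls_p_transfer p (normalizer G K) G"
proof -
  define a where "a = multiplicity p (order G)"
  have P: "subgroup P G" "card P = p ^ a"
    using sylow by (auto simp: sylow_subgroup_def a_def)
  have "order G \<noteq> 0" using fin order_gt_0_iff_finite by auto
  then obtain r where r: "order G = card P * r" "\<not> p dvd r"
    using multiplicity_decompose'[of "order G" p] p P(2) unfolding a_def
    by (metis not_prime_unit)
  have P_sub: "P \<subseteq> carrier G" and fin_P: "finite P"
    using subgroup.subset[OF P(1)] fin finite_subset by auto
  have K_P: "subgroup K (G\<lparr>carrier := P\<rparr>)" and
    closed: "\<And>g. \<lbrakk>g \<in> carrier G; conj_set G K g \<subseteq> P\<rbrakk> \<Longrightarrow> conj_set G K g = K"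
    using weakly by (auto simp: weakly_closed_def)
  have K: "subgroup K G" using incl_subgroup[OF P(1) K_P] .
  have K_sub: "K \<subseteq> P" using subgroup.subset[OF K_P] by simp
  have K_carrier: "K \<subseteq> carrier G" using K_sub P_sub by blast
  have "card K dvd p ^ a"
  proof -
    interpret P: group "G\<lparr>carrier := P\<rparr>" using P(1) by (rule subgroup_imp_group)
    have "card (rcosets\<^bsub>G\<lparr>carrier := P\<rparr>\<^esub> K) * card K = p ^ a"
      using P.lagrange[OF K_P] P(2) by (simp add: order_def)
    then show ?thesis by (metis dvd_triv_right)
  qed
  then obtain d where d: "card K = p ^ d"
    using divides_primepow_nat[OF p] by blast

  define N where "N = normalizer G K"
  have N: "subgroup N G"
    unfolding N_def by (rule normalizer_imp_subgroup[OF K_carrier])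
  have mem_N: "g \<in> N \<longleftrightarrow> g \<in> carrier G \<and> conj_set G K (inv g) = K" for g
    by (cases "g \<in> carrier G")
      (simp_all add: N_def mem_normalizer_iff[OF K_carrier] conj_set_def)
  have conj_in_P: "g \<in> N" if g: "g \<in> carrier G" "\<And>k. k \<in> K \<Longrightarrow> g \<otimes> k \<otimes> inv g \<in> P" for g
  proof -
    have "conj_set G K (inv g) \<subseteq> P"
      using g by (auto simp: mem_conj_set)
    then show ?thesis using closed[of "inv g"] g(1) by (simp add: mem_N)
  qed
  have P_N: "P \<subseteq> N"
  proof
    fix g assume g: "g \<in> P"
    show "g \<in> N"
    proof (rule conj_in_P)
      show "g \<in> carrier G" using g P_sub by blast
      show "g \<otimes> k \<otimes> inv g \<in> P" if "k \<in> K" for k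
        using that g K_sub by (intro subgroup.m_closed[OF P(1)] subgroup.m_inv_closed[OF P(1)]) auto
    qed
  qed

  interpret N: group "G\<lparr>carrier := N\<rparr>" using N by (rule subgroup_imp_group)
  have fin_N: "finite (carrier (G\<lparr>carrier := N\<rparr>))"
    using fin finite_subset[OF subgroup.subset[OF N]] by simp
  have P_in_N: "subgroup P (G\<lparr>carrier := N\<rparr>)"
    using P(1) N P_N by (simp add: subgroup_incl)
  define s where "s = card (rcosets\<^bsub>G\<lparr>carrier := N\<rparr>\<^esub> P)"
  have card_N: "card N = card P * s"
    using N.lagrange[OF P_in_N] by (simp add: s_def order_def mult.commute)
  have "card P > 0" using P(2) prime_gt_0_nat[OF p] by simp
  moreover have "card (rcosets N) * card N = order G" by (rule lagrange[OF N])
  ultimately have index: "card (rcosets N) * s = r"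
    using card_N r(1) by (simp add: mult.left_commute)
  have s: "\<not> p dvd s" using index r(2) by auto
  have "\<not> p dvd card (rcosets N)" using index r(2) by auto
  then have coprime: "coprime (card (rcosets N)) p"
    using prime_imp_coprime[OF p] coprime_commute by blast

  let ?A = "G\<lparr>carrier := N\<rparr> Mod A_p p (G\<lparr>carrier := N\<rparr>)"
  let ?\<phi> = "\<lambda>x. A_p p (G\<lparr>carrier := N\<rparr>) #>\<^bsub>G\<lparr>carrier := N\<rparr>\<^esub> x"
  note A_p = N.A_p_least[OF fin_N p]
  interpret A: comm_group ?A by (rule A_p(2))
  interpret transfer_setup G ?A N ?\<phi>
    by (intro transfer_setup.intro transfer_setup_axioms.intro is_group A.comm_group_axioms
        fin N normal.r_coset_hom_Mod[OF A_p(1)])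
  obtain b where b: "order ?A = p ^ b" using A_p(3) unfolding p_group_def by blast
  have "transfer ` carrier G = carrier ?A"
  proof (rule transfer_surjective[OF p b _ P(1) P_N P(2) card_N s K K_sub d])
    show "?\<phi> ` N = carrier ?A" by (simp add: carrier_FactGroup)
    show "\<exists>m::nat. k \<otimes> u \<otimes> inv k = u [^] m" if "k \<in> K" "u \<in> P" for k u
    proof (rule group_norm_normalizes_cyclic[OF P(1) fin_P _ _ \<open>u \<in> P\<close>])
      show "k \<in> group_norm (G\<lparr>carrier := P\<rparr>)"
        using \<open>k \<in> K\<close> norm by blast
      show "k \<in> P" using \<open>k \<in> K\<close> K_sub by blast
    qed
    show "c = N" if c: "c \<in> rcosets N" and fixed: "\<forall>k\<in>K. c #> k = c" for c
    proof -
      obtain t where t: "t \<in> carrier G" "c = N #> t" using c by (auto simp: RCOSETS_def)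
      have "t \<otimes> k \<otimes> inv t \<in> N" if "k \<in> K" for k
        using fixed that t K_carrier coset_translate_fixed_iff[OF N, of t k] by auto
      then obtain h where h: "h \<in> N" "\<And>k. k \<in> K \<Longrightarrow> (h \<otimes> t) \<otimes> k \<otimes> inv (h \<otimes> t) \<in> P"
        using p_subgroup_conj_into_sylow[OF fin p P(1) N P_N card_N s K d t(1)] by blast
      then have "h \<otimes> t \<in> N" using t(1) by (intro conj_in_P) auto
      then have "inv h \<otimes> (h \<otimes> t) \<in> N" using h(1) by simp
      then have "t \<in> N" using h(1) t(1) by (simp add: m_assoc[symmetric])
      then show ?thesis using t N by (simp add: coset_join2)
    qed
  qed
  then have "?A \<cong> G Mod A_p p G"
    by (rule A_p_quotients_iso_if_epimorphism[OF fin p P r N P_N transfer_hom])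
  then show ?thesis
    using N coprime unfolding controls_p_transfer_def N_def by blast
qed

theorem theorem1p10:
  fixes G :: "('a, 'b) monoid_scheme" and p :: nat and P K :: "'a set"
  assumes "group G" and "finite (carrier G)"
    and "Factorial_Ring.prime p" and "p dvd order G"
    and "sylow_subgroup p P G"
    and "subgroup K (G\<lparr>carrier := group_norm (G\<lparr>carrier := P\<rparr>)\<rparr>)"
    and "weakly_closed G P K"
  shows "controls_p_transfer p (normalizer G K) G"
proof (rule group.normalizer_controls_p_transfer[OF assms(1,2,3,5) _ assms(7)])
  show "K \<subseteq> group_norm (G\<lparr>carrier := P\<rparr>)"
    using subgroup.subset[OF assms(6)] by simp
qed

end
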